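(* Let $b\ge 0$ and consider the polynomial system (the case $a=c=0$) $$\dot x=x(1-y),\qquad \dot y=y(-1+x),\qquad \dot z=-bz.$$ (i) If $b=0$, the system is Darboux integrable with the first integrals $H_1=xy\exp(-x-y)$ and $H_2=z$. (ii) If $b>0$, the system is integrable with the first integrals $H_1=xy\exp(-x-y)$ and $H_2=z\,h(x,y)$, where $$h(x,y)=\exp\left(\int^{x}\frac{b}{s\left(W\!\left(-\frac{xy\,e^{s-x-y}}{s}\right)+1\right)}\,ds\right),$$ and $W$ denotes the principal branch of the Lambert $W$ function.
   Context: A first integral of a vector field $\mathcal{X}$ on an open set $U$ is a non-constant function $H$ with $\mathcal{X}H=0$ on $U$. Darboux integrable means having first integrals of Darboux type, i.e. of the form $f_1^{\lambda_1}\cdots f_p^{\lambda_p}E_1^{\mu_1}\cdots E_q^{\mu_q}$ with $f_i$ Darboux polynomials, $E_j$ exponential factors and $\lambda_i,\mu_j\in\mathbb{C}$. *)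

theory Defs
  imports "HOL-Analysis.Analysis"
begin

type_synonym pt3 = "real \<times> real \<times> real"

definition vf :: "real \<Rightarrow> pt3 \<Rightarrow> pt3" where
  "vf b v = (case v of (x, y, z) \<Rightarrow> (x * (1 - y), y * (-1 + x), - b * z))"

definition first_integral :: "(pt3 \<Rightarrow> pt3) \<Rightarrow> pt3 set \<Rightarrow> (pt3 \<Rightarrow> real) \<Rightarrow> bool" where
  "first_integral X U H \<longleftrightarrow> open U \<and> (\<exists>p\<in>U. \<exists>q\<in>U. H p \<noteq> H q) \<and>
     (\<forall>p\<in>U. \<exists>D. (H has_derivative D) (at p) \<and> D (X p) = 0)"

definition poly3 :: "(pt3 \<Rightarrow> real) \<Rightarrow> bool" where
  "poly3 F \<longleftrightarrow> (\<exists>N::nat. \<exists>c :: nat \<Rightarrow> nat \<Rightarrow> nat \<Rightarrow> real. \<forall>x y z.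
     F (x, y, z) = (\<Sum>i\<le>N. \<Sum>j\<le>N. \<Sum>k\<le>N. c i j k * x ^ i * y ^ j * z ^ k))"

definition darboux_poly :: "(pt3 \<Rightarrow> pt3) \<Rightarrow> (pt3 \<Rightarrow> real) \<Rightarrow> bool" where
  "darboux_poly X f \<longleftrightarrow> poly3 f \<and> (\<exists>p q. f p \<noteq> f q) \<and>
     (\<exists>K. poly3 K \<and> (\<forall>p. \<exists>D. (f has_derivative D) (at p) \<and> D (X p) = K p * f p))"

definition exp_factor :: "(pt3 \<Rightarrow> pt3) \<Rightarrow> (pt3 \<Rightarrow> real) \<Rightarrow> bool" where
  "exp_factor X E \<longleftrightarrow> (\<exists>g h. poly3 g \<and> poly3 h \<and> (h = (\<lambda>_. 1) \<or> darboux_poly X h) \<and>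
     (\<forall>p. h p \<noteq> 0 \<longrightarrow> E p = exp (g p / h p)) \<and>
     (\<exists>L. poly3 L \<and> (\<forall>p. h p \<noteq> 0 \<longrightarrow>
        (\<exists>D. (E has_derivative D) (at p) \<and> D (X p) = L p * E p))))"

definition darboux_type :: "(pt3 \<Rightarrow> pt3) \<Rightarrow> pt3 set \<Rightarrow> (pt3 \<Rightarrow> real) \<Rightarrow> bool" where
  "darboux_type X U H \<longleftrightarrow> (\<exists>(np::nat) (nq::nat) f (lam :: nat \<Rightarrow> complex) E (mu :: nat \<Rightarrow> complex).
     (\<forall>i<np. darboux_poly X (f i)) \<and> (\<forall>j<nq. exp_factor X (E j)) \<and>
     (\<forall>p\<in>U. complex_of_real (H p) =
        (\<Prod>i<np. complex_of_real (f i p) powr lam i) * (\<Prod>j<nq. complex_of_real (E j p) powr mu j)))"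

text \<open>Principal branch W_0 of the Lambert W function (meaningful for w \<ge> -1/e).\<close>
definition lambertW0 :: "real \<Rightarrow> real" where
  "lambertW0 w = (THE v. -1 \<le> v \<and> v * exp v = w)"

definition oint :: "real \<Rightarrow> real \<Rightarrow> (real \<Rightarrow> real) \<Rightarrow> real" where
  "oint a b f = (if a \<le> b then integral {a..b} f else - integral {b..a} f)"

definition H1 :: "pt3 \<Rightarrow> real" where
  "H1 v = (case v of (x, y, z) \<Rightarrow> x * y * exp (- x - y))"

definition hfun :: "real \<Rightarrow> real \<Rightarrow> real \<Rightarrow> real" where
  "hfun b x y = exp (oint 1 x (\<lambda>s. b / (s * (lambertW0 (- (x * y * exp (s - x - y)) / s) + 1))))"

end

theory Submission
  imports Defs
begin

(* H1 = x y e^(-x-y) is a first integral because the logarithmic derivatives of x, y and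
   e^(-x-y) along the field are 1 - y, x - 1 and y - x, which sum to zero. These are also the
   cofactors exhibiting x and y as Darboux polynomials and e^(-x-y) as an exponential factor;
   z is a Darboux polynomial with cofactor -b.

   For (ii), on the level set H1 = c the coordinate y < 1 is recovered from x through the
   principal Lambert branch, -y = W(-c e^x / x), so x' = x (1 - y) = x (W(-c e^x / x) + 1).
   Hence G(x, c) = int_1^x b / (s (W(-c e^s / s) + 1)) ds grows at rate b along orbits while z
   decays at rate b, and z e^G is constant. The work lies in the joint differentiability of G
   in (x, c): after substituting s = 1 + t (x - 1) the integral runs over [0, 1] and is
   differentiated under the integral sign. The integrand is smooth along the whole path
   because s e^(-s) is maximal at s = 1, which keeps the argument of W above -1/e.

   Neither part uses the hypothesis b >= 0. *)

lemma xexp_strict_mono: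
  fixes u v :: real
  assumes "-1 \<le> u" "u < v"
  shows "u * exp u < v * exp v"
proof (rule DERIV_pos_imp_increasing_open[OF assms(2)])
  fix t assume "u < t" "t < v"
  then show "\<exists>y. ((\<lambda>v. v * exp v) has_real_derivative y) (at t) \<and> y > 0"
  proof (intro exI conjI)
    show "((\<lambda>v. v * exp v) has_real_derivative (1 + t) * exp t) (at t)"
      by (auto intro!: derivative_eq_intros simp: algebra_simps)
    show "0 < (1 + t) * exp t" using assms \<open>u < t\<close> by simp
  qed
qed (intro continuous_intros)

lemma xexp_inj:
  fixes u v :: real
  assumes "-1 \<le> u" "-1 \<le> v" "u * exp u = v * exp v"
  shows "u = v"
  using xexp_strict_mono[of u v] xexp_strict_mono[of v u] assms
  by (cases u v rule: linorder_cases) auto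

lemma xexp_neg_increasing:
  fixes x s :: real
  assumes "x \<le> s" "s \<le> 1"
  shows "x * exp (- x) \<le> s * exp (- s)"
proof (rule DERIV_nonneg_imp_increasing_open[OF assms(1)])
  fix t :: real assume "t < s"
  then show "\<exists>y. ((\<lambda>t. t * exp (- t)) has_real_derivative y) (at t) \<and> 0 \<le> y"
    using assms by (intro exI[of _ "(1 - t) * exp (- t)"])
      (auto intro!: derivative_eq_intros simp: algebra_simps)
qed (intro continuous_intros)

lemma xexp_neg_decreasing:
  fixes x s :: real
  assumes "1 \<le> s" "s \<le> x"
  shows "x * exp (- x) \<le> s * exp (- s)"
proof (rule DERIV_nonpos_imp_decreasing_open[OF assms(2)])
  fix t :: real assume "s < t"
  then show "\<exists>y. ((\<lambda>t. t * exp (- t)) has_real_derivative y) (at t) \<and> y \<le> 0"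
    using assms by (intro exI[of _ "(1 - t) * exp (- t)"])
      (auto intro!: derivative_eq_intros simp: algebra_simps)
qed (intro continuous_intros)

section \<open>The principal branch of the Lambert W function\<close>

lemma lambertW0_mult_exp:
  assumes "-1 \<le> v"
  shows "lambertW0 (v * exp v) = v"
  unfolding lambertW0_def by (rule the_equality) (use assms xexp_inj in auto)

lemma lambertW0:
  assumes "- exp (-1) \<le> w"
  shows lambertW0_ge: "-1 \<le> lambertW0 w"
    and mult_exp_lambertW0: "lambertW0 w * exp (lambertW0 w) = w"
proof -
  have "w \<le> (\<bar>w\<bar> + 1) * exp (\<bar>w\<bar> + 1)"
    using mult_left_mono[of 1 "exp (\<bar>w\<bar> + 1)" "\<bar>w\<bar> + 1"] by (simp add: one_le_exp_iff)
  with assms obtain v where "-1 \<le> v" "v * exp v = w"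
    using IVT'[of "\<lambda>v. v * exp v" "-1" w "\<bar>w\<bar> + 1"] by (force intro: continuous_intros)
  then show "-1 \<le> lambertW0 w" "lambertW0 w * exp (lambertW0 w) = w"
    using lambertW0_mult_exp by auto
qed

lemma lambertW0_gt:
  assumes "- exp (-1) < w"
  shows "-1 < lambertW0 w"
proof -
  have "lambertW0 w \<noteq> -1"
    using mult_exp_lambertW0[of w] assms by auto
  with lambertW0_ge[of w] assms show ?thesis by simp
qed

definition lambertW0' :: "real \<Rightarrow> real" where
  "lambertW0' w = inverse ((1 + lambertW0 w) * exp (lambertW0 w))"

lemma isCont_lambertW0:
  assumes "- exp (-1) < w"
  shows "isCont lambertW0 w"
proof -
  let ?v = "lambertW0 w"
  have "isCont lambertW0 (?v * exp ?v)"
  proof (rule isCont_inverse_function[where f = "\<lambda>v. v * exp v" and d = "(?v + 1) / 2"])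
    show "0 < (?v + 1) / 2" using lambertW0_gt[OF assms] by simp
    show "lambertW0 (z * exp z) = z" if "\<bar>z - ?v\<bar> \<le> (?v + 1) / 2" for z
    proof (rule lambertW0_mult_exp)
      show "-1 \<le> z" using that abs_ge_minus_self[of "z - ?v"] lambertW0_gt[OF assms] by simp
    qed
  qed (intro continuous_intros)
  then show ?thesis using mult_exp_lambertW0[of w] assms by simp
qed

lemma has_real_derivative_lambertW0:
  assumes "- exp (-1) < w"
  shows "(lambertW0 has_real_derivative lambertW0' w) (at w)"
  unfolding lambertW0'_def
proof (rule DERIV_inverse_function[where f = "\<lambda>v. v * exp v" and a = "- exp (-1)" and b = "w + 1"])
  show "((\<lambda>v. v * exp v) has_real_derivative (1 + lambertW0 w) * exp (lambertW0 w)) (at (lambertW0 w))"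
    by (auto intro!: derivative_eq_intros simp: algebra_simps)
  show "(1 + lambertW0 w) * exp (lambertW0 w) \<noteq> 0" using lambertW0_gt[OF assms] by simp
  show "lambertW0 y * exp (lambertW0 y) = y" if "- exp (-1) < y" for y
    using mult_exp_lambertW0 that by simp
qed (use assms isCont_lambertW0 in auto)

lemma continuous_on_lambertW0 [continuous_intros]:
  assumes "continuous_on S f" "\<And>x. x \<in> S \<Longrightarrow> - exp (-1) < f x"
  shows "continuous_on S (\<lambda>x. lambertW0 (f x))"
  using continuous_on_compose2[OF _ assms(1), of "{- exp (-1)<..}" lambertW0] assms(2)
  by (force intro: continuous_at_imp_continuous_on isCont_lambertW0)

lemma continuous_on_lambertW0' [continuous_intros]:
  assumes "continuous_on S f" "\<And>x. x \<in> S \<Longrightarrow> - exp (-1) < f x"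
  shows "continuous_on S (\<lambda>x. lambertW0' (f x))"
proof -
  have "(1 + lambertW0 (f x)) * exp (lambertW0 (f x)) \<noteq> 0" if "x \<in> S" for x
    using lambertW0_gt[OF assms(2)[OF that]] by (simp add: add_eq_0_iff)
  then show ?thesis
    unfolding lambertW0'_def by (intro continuous_intros assms) auto
qed

lemma has_derivative_lambertW0 [derivative_intros]:
  assumes "(f has_derivative f') (at x within S)" "- exp (-1) < f x"
  shows "((\<lambda>x. lambertW0 (f x)) has_derivative (\<lambda>h. lambertW0' (f x) * f' h)) (at x within S)"
  using has_derivative_compose[OF assms(1) has_real_derivative_lambertW0[OF assms(2),
        unfolded has_field_derivative_def]] .

section \<open>Differentiating an oriented integral in its endpoint and a parameter\<close>

lemma affine_in_closed_segment:
  fixes a x t :: real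
  assumes "0 \<le> t" "t \<le> 1"
  shows "a + t * (x - a) \<in> closed_segment a x"
  using assms unfolding in_segment by (intro exI[of _ t]) (simp add: algebra_simps)

lemma oint_eq_integral_affine:
  fixes f :: "real \<Rightarrow> real"
  assumes "continuous_on (closed_segment a x) f"
  shows "oint a x f = integral {0..1} (\<lambda>t. (x - a) * f (a + t * (x - a)))"
proof -
  have segment: "closed_segment a x = {min a x..max a x}"
    by (simp add: closed_segment_eq_real_ivl)
  have "((\<lambda>t. (x - a) *\<^sub>R f (a + t * (x - a))) has_integral
      integral {a + 0 * (x - a)..a + 1 * (x - a)} f - integral {a + 1 * (x - a)..a + 0 * (x - a)} f) {0..1}"
  proof (rule has_integral_substitution_general[of "{}" 0 1 _ "min a x" "max a x"])
    show "(\<lambda>t. a + t * (x - a)) ` {0..1} \<subseteq> {min a x..max a x}"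
      using affine_in_closed_segment[of _ a x] by (auto simp: segment)
    show "continuous_on {min a x..max a x} f"
      using assms by (simp add: segment)
    show "((\<lambda>t. a + t * (x - a)) has_real_derivative x - a) (at t within {0..1})" for t
      by (auto intro!: derivative_eq_intros)
  qed (auto intro!: continuous_intros)
  then show ?thesis
    unfolding oint_def by (cases "a = x") (auto dest: integral_unique)
qed

lemma has_derivative_affine_reparametrized:
  fixes g :: "real \<times> real \<Rightarrow> real"
  assumes g: "(g has_derivative (\<lambda>h. gs * fst h + gc * snd h)) (at (a + t * (x - a), c))"
  shows "((\<lambda>(x, c). (x - a) * g (a + t * (x - a), c)) has_derivative
      (\<lambda>k. (g (a + t * (x - a), c) + t * (x - a) * gs) * fst k + (x - a) * gc * snd k)) (at (x, c) within U)"
proof -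
  have "((\<lambda>p. (a + t * (fst p - a), snd p)) has_derivative (\<lambda>k. (t * fst k, snd k))) (at (x, c) within U)"
    by (rule has_derivative_eq_rhs, (rule derivative_intros)+) auto
  from has_derivative_compose[OF this, of g "\<lambda>h. gs * fst h + gc * snd h"] g
  have "((\<lambda>p. g (a + t * (fst p - a), snd p)) has_derivative (\<lambda>k. gs * (t * fst k) + gc * snd k))
      (at (x, c) within U)"
    by simp
  from has_derivative_mult[OF has_derivative_diff[OF has_derivative_fst[OF has_derivative_ident]
        has_derivative_const[of a]] this]
  show ?thesis
    unfolding case_prod_beta by (rule has_derivative_eq_rhs) (auto simp: algebra_simps)
qed

lemma integral_affine_reparametrized_derivative:
  fixes g :: "real \<times> real \<Rightarrow> real"
  assumes "\<And>t. 0 \<le> t \<Longrightarrow> t \<le> 1 \<Longrightarrow>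
      (g has_derivative (\<lambda>h. gs (a + t * (x - a), c) * fst h + gc (a + t * (x - a), c) * snd h))
        (at (a + t * (x - a), c))"
  shows "integral {0..1} (\<lambda>t. g (a + t * (x - a), c) + t * (x - a) * gs (a + t * (x - a), c)) = g (x, c)"
proof -
  have "((\<lambda>t. t * g (a + t * (x - a), c)) has_real_derivative
      g (a + t * (x - a), c) + t * (x - a) * gs (a + t * (x - a), c)) (at t within {0..1})"
    if "0 \<le> t" "t \<le> 1" for t
  proof -
    have "((\<lambda>t. (a + t * (x - a), c)) has_derivative (\<lambda>h. (h * (x - a), 0))) (at t within {0..1})"
      by (rule has_derivative_eq_rhs, (rule derivative_intros)+) auto
    from has_derivative_compose[OF this assms[OF that]]
    have "((\<lambda>t. g (a + t * (x - a), c)) has_derivative (\<lambda>h. gs (a + t * (x - a), c) * (h * (x - a))))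
        (at t within {0..1})"
      by simp
    from has_derivative_mult[OF has_derivative_ident this]
    show ?thesis
      unfolding has_field_derivative_def by (rule has_derivative_eq_rhs) (auto simp: algebra_simps)
  qed
  then have "((\<lambda>t. g (a + t * (x - a), c) + t * (x - a) * gs (a + t * (x - a), c)) has_integral
      1 * g (a + 1 * (x - a), c) - 0 * g (a + 0 * (x - a), c)) {0..1}"
    by (intro fundamental_theorem_of_calculus) (auto simp: has_real_derivative_iff_has_vector_derivative)
  then show ?thesis by (simp add: integral_unique)
qed

lemma blinfun_apply_scaleR_fst_snd:
  "blinfun_apply (u *\<^sub>R fst_blinfun + v *\<^sub>R snd_blinfun) = (\<lambda>h :: real \<times> real. u * fst h + v * snd h)"
  by (rule ext) (simp add: plus_blinfun.rep_eq scaleR_blinfun.rep_eq)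

lemma continuous_on_affine_reparametrized:
  fixes h :: "real \<times> real \<Rightarrow> real"
  assumes "continuous_on S h"
    and "\<And>x c t. (x, c) \<in> B \<Longrightarrow> 0 \<le> t \<Longrightarrow> t \<le> 1 \<Longrightarrow> (a + t * (x - a), c) \<in> S"
  shows "continuous_on (B \<times> {0..1}) (\<lambda>(p, t). h (a + t * (fst p - a), snd p))"
proof -
  have "continuous_on (B \<times> {0..1}) (\<lambda>(p, t). (a + t * (fst p - a), snd p))"
    by (simp add: case_prod_beta continuous_intros)
  moreover have "(\<lambda>(p, t). (a + t * (fst p - a), snd p)) ` (B \<times> {0..1}) \<subseteq> S"
    using assms(2) by force
  ultimately show ?thesis
    using continuous_on_compose2[OF assms(1)] by (simp add: case_prod_beta)
qed

lemma has_derivative_integral_affine_reparametrized: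
  fixes g gs gc :: "real \<times> real \<Rightarrow> real"
  assumes "convex B" "(x0, c0) \<in> B"
    and path: "\<And>x c t. (x, c) \<in> B \<Longrightarrow> 0 \<le> t \<Longrightarrow> t \<le> 1 \<Longrightarrow> (a + t * (x - a), c) \<in> S"
    and deriv: "\<And>p. p \<in> S \<Longrightarrow> (g has_derivative (\<lambda>h. gs p * fst h + gc p * snd h)) (at p)"
    and cont: "continuous_on S gs" "continuous_on S gc"
  shows "\<exists>D. ((\<lambda>p. integral {0..1} (\<lambda>t. (fst p - a) * g (a + t * (fst p - a), snd p))) has_derivative D)
      (at (x0, c0) within B) \<and> (\<forall>h. D (h, 0) = h * g (x0, c0))"
proof -
  define f where "f p t = (fst p - a) * g (a + t * (fst p - a), snd p)" for p t
  define fx :: "real \<times> real \<Rightarrow> real \<Rightarrow> (real \<times> real) \<Rightarrow>\<^sub>L real" where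
    "fx p t = (g (a + t * (fst p - a), snd p) + t * (fst p - a) * gs (a + t * (fst p - a), snd p)) *\<^sub>R fst_blinfun +
      ((fst p - a) * gc (a + t * (fst p - a), snd p)) *\<^sub>R snd_blinfun" for p t
  have "continuous_on S g"
    using deriv has_derivative_continuous by (blast intro: continuous_at_imp_continuous_on)
  note reparam = continuous_on_affine_reparametrized[OF _ path]
  have cont_f: "continuous_on (B \<times> {0..1}) (\<lambda>(p, t). f p t)"
    using reparam[OF \<open>continuous_on S g\<close>] unfolding f_def case_prod_beta by (auto intro!: continuous_intros)
  have cont_fx: "continuous_on (B \<times> {0..1}) (\<lambda>(p, t). fx p t)"
    using reparam[OF \<open>continuous_on S g\<close>] reparam[OF cont(1)] reparam[OF cont(2)]
    unfolding fx_def case_prod_beta by (auto intro!: continuous_intros)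
  have "((\<lambda>p. integral (cbox 0 1) (f p)) has_derivative
      blinfun_apply (integral (cbox 0 1) (fx (x0, c0)))) (at (x0, c0) within B)"
  proof (rule leibniz_rule)
    fix p t assume "p \<in> B" "t \<in> cbox (0::real) 1"
    moreover obtain x c where p: "p = (x, c)" by fastforce
    ultimately have "(a + t * (x - a), c) \<in> S" using path by simp
    from has_derivative_affine_reparametrized[OF deriv[OF this], of B]
    show "((\<lambda>p. f p t) has_derivative blinfun_apply (fx p t)) (at p within B)"
      by (simp add: p f_def fx_def split_def blinfun_apply_scaleR_fst_snd)
  next
    fix p assume "p \<in> B"
    from continuous_on_o_Pair[OF cont_f this] show "f p integrable_on cbox 0 1"
      by (simp add: o_def integrable_continuous_interval)
  qed (use cont_fx assms(1,2) in auto)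
  moreover have "blinfun_apply (integral (cbox 0 1) (fx (x0, c0))) (h, 0) = h * g (x0, c0)" for h
  proof -
    from continuous_on_o_Pair[OF cont_fx assms(2)]
    have "blinfun_apply (integral (cbox 0 1) (fx (x0, c0))) (h, 0) =
        h * integral {0..1} (\<lambda>t. g (a + t * (x0 - a), c0) + t * (x0 - a) * gs (a + t * (x0 - a), c0))"
      by (simp add: o_def blinfun_apply_integral integrable_continuous_interval fx_def
          blinfun_apply_scaleR_fst_snd mult.commute)
    also have "\<dots> = h * g (x0, c0)"
      using integral_affine_reparametrized_derivative[OF deriv] path assms(2) by simp
    finally show ?thesis .
  qed
  ultimately show ?thesis
    unfolding f_def by auto
qed

lemma has_derivative_oint_parametric:
  fixes g gs gc :: "real \<times> real \<Rightarrow> real"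
  assumes "open V" "(x0, c0) \<in> V"
    and segment: "\<And>x c s. (x, c) \<in> V \<Longrightarrow> s \<in> closed_segment a x \<Longrightarrow> (s, c) \<in> S"
    and deriv: "\<And>p. p \<in> S \<Longrightarrow> (g has_derivative (\<lambda>h. gs p * fst h + gc p * snd h)) (at p)"
    and cont: "continuous_on S gs" "continuous_on S gc"
  shows "\<exists>D. ((\<lambda>(x, c). oint a x (\<lambda>s. g (s, c))) has_derivative D) (at (x0, c0)) \<and>
    (\<forall>h. D (h, 0) = h * g (x0, c0))"
proof -
  obtain r where "0 < r" and ball: "ball (x0, c0) r \<subseteq> V"
    using assms(1,2) openE by blast
  define B where "B = ball (x0, c0) r"
  have B: "open B" "convex B" "(x0, c0) \<in> B"
    using \<open>0 < r\<close> by (auto simp: B_def)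
  have path: "(a + t * (x - a), c) \<in> S" if "(x, c) \<in> B" "0 \<le> t" "t \<le> 1" for x c t
    using that ball segment affine_in_closed_segment by (auto simp: B_def)
  obtain D where D: "((\<lambda>p. integral {0..1} (\<lambda>t. (fst p - a) * g (a + t * (fst p - a), snd p)))
      has_derivative D) (at (x0, c0))" "\<And>h. D (h, 0) = h * g (x0, c0)"
    using has_derivative_integral_affine_reparametrized[OF B(2,3) path deriv cont]
    unfolding at_within_open[OF B(3,1)] by blast
  have "continuous_on S g"
    using deriv has_derivative_continuous by (blast intro: continuous_at_imp_continuous_on)
  have "((\<lambda>(x, c). oint a x (\<lambda>s. g (s, c))) has_derivative D) (at (x0, c0))"
  proof (rule has_derivative_transform_within_open[OF D(1) B(1,3)])
    fix p assume "p \<in> B"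
    then have "(\<lambda>s. (s, snd p)) ` closed_segment a (fst p) \<subseteq> S"
      using ball segment[of "fst p" "snd p"] by (auto simp: B_def)
    from continuous_on_compose2[OF \<open>continuous_on S g\<close> _ this]
    have "continuous_on (closed_segment a (fst p)) (\<lambda>s. g (s, snd p))"
      by (simp add: continuous_on_Pair continuous_on_id continuous_on_const)
    then show "integral {0..1} (\<lambda>t. (fst p - a) * g (a + t * (fst p - a), snd p)) =
        (\<lambda>(x, c). oint a x (\<lambda>s. g (s, c))) p"
      by (simp add: oint_eq_integral_affine split_def)
  qed
  with D(2) show ?thesis by blast
qed

section \<open>The integrating factor h\<close>

definition h_integrand :: "real \<Rightarrow> real \<times> real \<Rightarrow> real" where
  "h_integrand b p = b / (fst p * (lambertW0 (- snd p * exp (fst p) / fst p) + 1))"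

definition h_domain :: "(real \<times> real) set" where
  "h_domain = {(s, c). 0 < s \<and> c * exp s < s * exp (-1)}"

lemma h_domain_lambertW0_arg:
  assumes "p \<in> h_domain"
  shows "0 < fst p" "- exp (-1) < - snd p * exp (fst p) / fst p"
  using assms by (auto simp: h_domain_def field_simps)

lemma h_integrand_continuously_differentiable:
  obtains gs gc where "continuous_on h_domain gs" "continuous_on h_domain gc"
    "\<And>p. p \<in> h_domain \<Longrightarrow> (h_integrand b has_derivative (\<lambda>k. gs p * fst k + gc p * snd k)) (at p)"
proof -
  define w where "w p = - snd p * exp (fst p) / fst p" for p :: "real \<times> real"
  define den where "den p = fst p * (lambertW0 (w p) + 1)" for p
  define den_s where "den_s p =
      lambertW0 (w p) + 1 + lambertW0' (w p) * snd p * exp (fst p) * (1 - fst p) / fst p" for p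
  define den_c where "den_c p = - lambertW0' (w p) * exp (fst p)" for p
  have dom: "0 < fst p" "- exp (-1) < w p" "den p \<noteq> 0" if "p \<in> h_domain" for p
    using h_domain_lambertW0_arg[OF that] lambertW0_gt[of "w p"] by (auto simp: w_def den_def)
  show thesis
  proof
    show "continuous_on h_domain (\<lambda>p. - b * den_s p / (den p)\<^sup>2)"
      "continuous_on h_domain (\<lambda>p. - b * den_c p / (den p)\<^sup>2)"
      unfolding den_s_def den_c_def den_def w_def
      using dom by (auto simp: w_def den_def intro!: continuous_intros)
    fix p assume "p \<in> h_domain"
    obtain s c where p: "p = (s, c)" by fastforce
    define U where "U = lambertW0 (- (c * exp s / s)) + 1"
    define W' where "W' = lambertW0' (- (c * exp s / s))"
    have W: "lambertW0 (- (c * exp s / s)) = U - 1" by (simp add: U_def)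
    have nonzero: "U \<noteq> 0" "s \<noteq> 0"
      using dom[OF \<open>p \<in> h_domain\<close>] by (auto simp: p U_def den_def w_def)
    show "(h_integrand b has_derivative
        (\<lambda>k. - b * den_s p / (den p)\<^sup>2 * fst k + - b * den_c p / (den p)\<^sup>2 * snd k)) (at p)"
      unfolding h_integrand_def[abs_def]
      apply (rule has_derivative_eq_rhs)
       apply (rule derivative_intros
          | use dom[OF \<open>p \<in> h_domain\<close>] in \<open>simp add: w_def den_def; fail\<close>)+
      apply (rule ext)
      using nonzero apply (simp add: p den_s_def den_c_def den_def w_def W W'_def[symmetric]
          field_simps power2_eq_square)
      done
  qed
qed

definition h_region :: "(real \<times> real) set" where
  "h_region = {(x, c). 0 < x \<and> c < x * exp (- x - 1)}"

lemma open_h_region: "open h_region"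
proof -
  have "h_region = {p. 0 < fst p} \<inter> {p. snd p < fst p * exp (- fst p - 1)}"
    by (auto simp: h_region_def)
  also have "open \<dots>"
    by (intro open_Int open_Collect_less continuous_intros)
  finally show ?thesis .
qed

lemma closed_segment_in_h_domain:
  assumes "(x, c) \<in> h_region" "s \<in> closed_segment 1 x"
  shows "(s, c) \<in> h_domain"
proof -
  have "0 < x" "c < x * exp (- x) * exp (-1)"
    using assms(1) by (auto simp: h_region_def mult.assoc simp flip: exp_add)
  moreover have "0 < s" "x * exp (- x) \<le> s * exp (- s)"
    using assms(2) \<open>0 < x\<close> xexp_neg_increasing[of x s] xexp_neg_decreasing[of s x]
    by (auto simp: closed_segment_eq_real_ivl split: if_splits)
  ultimately have "c * exp s < s * exp (- s) * exp (-1) * exp s"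
    by (smt (verit) exp_gt_zero mult_right_mono mult_strict_right_mono)
  also have "\<dots> = s * exp (-1)"
    by (simp add: exp_minus field_simps)
  finally show ?thesis using \<open>0 < s\<close> by (simp add: h_domain_def)
qed

definition h_potential :: "real \<Rightarrow> real \<times> real \<Rightarrow> real" where
  "h_potential b = (\<lambda>(x, c). oint 1 x (\<lambda>s. h_integrand b (s, c)))"

lemma has_derivative_h_potential:
  assumes "p \<in> h_region"
  obtains D where "(h_potential b has_derivative D) (at p)" "\<And>h. D (h, 0) = h * h_integrand b p"
proof -
  obtain gs gc where "continuous_on h_domain gs" "continuous_on h_domain gc"
    "\<And>p. p \<in> h_domain \<Longrightarrow> (h_integrand b has_derivative (\<lambda>k. gs p * fst k + gc p * snd k)) (at p)"
    using h_integrand_continuously_differentiable[of b] by metis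
  moreover obtain x c where p: "p = (x, c)" by fastforce
  ultimately have "\<exists>D. ((\<lambda>(x, c). oint 1 x (\<lambda>s. h_integrand b (s, c))) has_derivative D)
      (at (x, c)) \<and> (\<forall>h. D (h, 0) = h * h_integrand b (x, c))"
    using assms closed_segment_in_h_domain
    by (intro has_derivative_oint_parametric[OF open_h_region, where gs = gs and gc = gc]) auto
  then show thesis
    using that by (auto simp: h_potential_def p)
qed

lemma hfun_eq_h_potential: "hfun b x y = exp (h_potential b (x, H1 (x, y, z)))"
proof -
  have "exp (s - x - y) = exp (- x - y) * exp s" for s
    by (simp flip: exp_add)
  then show ?thesis
    by (simp add: hfun_def h_potential_def h_integrand_def H1_def mult.assoc)
qed

lemma H1_in_h_region:
  assumes "0 < x" "y < 1"
  shows "(x, H1 (x, y, z)) \<in> h_region"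
proof -
  have "y * exp (- y) < exp (-1)"
    using xexp_strict_mono[of "-1" "-y"] assms(2) by simp
  then have "x * exp (- x) * (y * exp (- y)) < x * exp (- x) * exp (-1)"
    using assms(1) by simp
  moreover have "exp (- x - y) = exp (- x) * exp (- y)" "exp (- x - 1) = exp (- x) * exp (-1)"
    by (simp_all flip: exp_add)
  ultimately show ?thesis
    using assms(1) by (simp add: h_region_def H1_def mult_ac)
qed

lemma h_integrand_at_H1:
  assumes "0 < x" "y < 1"
  shows "h_integrand b (x, H1 (x, y, z)) = b / (x * (1 - y))"
proof -
  have "- H1 (x, y, z) * exp x / x = (- y) * exp (- y)"
    using assms(1) by (simp add: H1_def field_simps flip: exp_add)
  then show ?thesis
    unfolding h_integrand_def fst_conv snd_conv using lambertW0_mult_exp[of "- y"] assms(2) by simp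
qed

lemma H1_derivative_along_vf:
  obtains D where "(H1 has_derivative D) (at p)" "D (vf b p) = 0"
proof -
  obtain x y z where p: "p = (x, y, z)" by (metis prod.collapse)
  define D where "D k = (fst k * y + x * fst (snd k)) * exp (- x - y) -
      x * y * exp (- x - y) * (fst k + fst (snd k))" for k :: pt3
  have "H1 = (\<lambda>v. fst v * fst (snd v) * exp (- fst v - fst (snd v)))"
    by (auto simp: H1_def)
  moreover have "((\<lambda>v. fst v * fst (snd v) * exp (- fst v - fst (snd v))) has_derivative D) (at p)"
    unfolding p D_def by (rule has_derivative_eq_rhs, (rule derivative_intros)+) (auto simp: algebra_simps)
  moreover have "D (vf b p) = 0"
    by (simp add: D_def p vf_def algebra_simps)
  ultimately show thesis
    using that by simp
qed

lemma H2_derivative_along_vf: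
  assumes "0 < x" "y < 1"
  obtains D where "((\<lambda>(x, y, z). z * hfun b x y) has_derivative D) (at (x, y, z))"
    "D (vf b (x, y, z)) = 0"
proof -
  let ?p = "(x, y, z)"
  obtain DH where DH: "(H1 has_derivative DH) (at ?p)" "DH (vf b ?p) = 0"
    by (rule H1_derivative_along_vf)
  obtain DG where DG: "(h_potential b has_derivative DG) (at (x, H1 ?p))"
    "\<And>h. DG (h, 0) = h * h_integrand b (x, H1 ?p)"
    using has_derivative_h_potential[OF H1_in_h_region[OF assms]] by blast
  define G where "G v = h_potential b (fst v, H1 v)" for v
  have "((\<lambda>v. (fst v, H1 v)) has_derivative (\<lambda>k. (fst k, DH k))) (at ?p)"
    by (intro has_derivative_Pair has_derivative_fst[OF has_derivative_ident] DH(1))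
  from has_derivative_compose[OF this, of "h_potential b" DG] DG(1)
  have "(G has_derivative (\<lambda>k. DG (fst k, DH k))) (at ?p)"
    by (simp add: G_def[abs_def])
  then have "((\<lambda>v. snd (snd v) * exp (G v)) has_derivative
      (\<lambda>k. z * (exp (G ?p) * DG (fst k, DH k)) + snd (snd k) * exp (G ?p))) (at ?p)"
    by (auto intro!: derivative_eq_intros)
  moreover have "(\<lambda>(x, y, z). z * hfun b x y) = (\<lambda>v. snd (snd v) * exp (G v))"
    by (auto simp: hfun_eq_h_potential G_def)
  moreover have "DG (fst (vf b ?p), DH (vf b ?p)) = b"
    using DG(2) DH(2) h_integrand_at_H1[OF assms] assms by (simp add: vf_def)
  ultimately show thesis
    by (intro that[of "\<lambda>k. z * (exp (G ?p) * DG (fst k, DH k)) + snd (snd k) * exp (G ?p)"])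
      (simp_all add: vf_def)
qed

section \<open>Darboux polynomials and exponential factors\<close>

lemma poly3_affine:
  assumes "\<And>x y z. F (x, y, z) = a + ax * x + ay * y + az * z"
  shows "poly3 F"
  unfolding poly3_def
proof (intro exI allI)
  fix x y z :: real
  let ?c = "\<lambda>i j k. if i = 0 \<and> j = 0 \<and> k = 0 then a else if i = 1 \<and> j = 0 \<and> k = 0 then ax
     else if i = 0 \<and> j = 1 \<and> k = 0 then ay else if i = 0 \<and> j = 0 \<and> k = 1 then az else (0::real)"
  show "F (x, y, z) = (\<Sum>i\<le>Suc 0. \<Sum>j\<le>Suc 0. \<Sum>k\<le>Suc 0. ?c i j k * x ^ i * y ^ j * z ^ k)"
    using assms by simp
qed

lemma darboux_poly_linear:
  fixes f :: "pt3 \<Rightarrow> real"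
  assumes f: "\<And>x y z. f (x, y, z) = ax * x + ay * y + az * z"
    and "f p \<noteq> f q" "poly3 K" "\<And>p. f (X p) = K p * f p"
  shows "darboux_poly X f"
proof -
  have "f = (\<lambda>v. ax * fst v + ay * fst (snd v) + az * snd (snd v))"
    using f by (auto simp: fun_eq_iff)
  moreover have "((\<lambda>v. ax * fst v + ay * fst (snd v) + az * snd (snd v)) has_derivative
      (\<lambda>v. ax * fst v + ay * fst (snd v) + az * snd (snd v))) (at p)" for p
    by (rule has_derivative_eq_rhs, (rule derivative_intros)+) auto
  ultimately have "(f has_derivative f) (at p)" for p
    by simp
  moreover have "poly3 f"
    using f by (intro poly3_affine[where a = 0]) simp
  ultimately show ?thesis
    unfolding darboux_poly_def using assms by blast
qed

lemma darboux_poly_x: "darboux_poly (vf b) fst"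
  by (rule darboux_poly_linear[where ax = 1 and ay = 0 and az = 0 and K = "\<lambda>v. 1 - fst (snd v)"
        and p = "(0, 0, 0)" and q = "(1, 0, 0)"])
    (auto simp: vf_def split: prod.splits
      intro: poly3_affine[where a = 1 and ax = 0 and ay = "-1" and az = 0])

lemma darboux_poly_y: "darboux_poly (vf b) (\<lambda>v. fst (snd v))"
  by (rule darboux_poly_linear[where ax = 0 and ay = 1 and az = 0 and K = "\<lambda>v. fst v - 1"
        and p = "(0, 0, 0)" and q = "(0, 1, 0)"])
    (auto simp: vf_def split: prod.splits
      intro: poly3_affine[where a = "-1" and ax = 1 and ay = 0 and az = 0])

lemma darboux_poly_z: "darboux_poly (vf b) (\<lambda>v. snd (snd v))"
  by (rule darboux_poly_linear[where ax = 0 and ay = 0 and az = 1 and K = "\<lambda>v. - b"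
        and p = "(0, 0, 0)" and q = "(0, 0, 1)"])
    (auto simp: vf_def split: prod.splits
      intro: poly3_affine[where a = "-b" and ax = 0 and ay = 0 and az = 0])

lemma exp_factor_exp_neg_x_y: "exp_factor (vf b) (\<lambda>v. exp (- fst v - fst (snd v)))"
  unfolding exp_factor_def
proof (rule exI[of _ "\<lambda>v. - fst v - fst (snd v)"], rule exI[of _ "\<lambda>_. 1"], intro conjI)
  have "\<exists>D. ((\<lambda>v. exp (- fst v - fst (snd v))) has_derivative D) (at p) \<and>
      D (vf b p) = (fst (snd p) - fst p) * exp (- fst p - fst (snd p))" for p
  proof (intro exI conjI)
    show "((\<lambda>v. exp (- fst v - fst (snd v))) has_derivative
        (\<lambda>k. exp (- fst p - fst (snd p)) * (- fst k - fst (snd k)))) (at p)"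
      by (rule has_derivative_eq_rhs, (rule derivative_intros)+) (auto simp: algebra_simps)
  qed (auto simp: vf_def algebra_simps split: prod.splits)
  moreover have "poly3 (\<lambda>v. fst (snd v) - fst v)"
    by (rule poly3_affine[where a = 0 and ax = "-1" and ay = 1 and az = 0]) simp
  ultimately show "\<exists>L. poly3 L \<and> (\<forall>p. (1::real) \<noteq> 0 \<longrightarrow>
      (\<exists>D. ((\<lambda>v. exp (- fst v - fst (snd v))) has_derivative D) (at p) \<and>
        D (vf b p) = L p * exp (- fst p - fst (snd p))))"
    by blast
  show "poly3 (\<lambda>v. - fst v - fst (snd v))"
    by (rule poly3_affine[where a = 0 and ax = "-1" and ay = "-1" and az = 0]) simp
  show "poly3 (\<lambda>_. 1)"
    by (rule poly3_affine[where a = 1 and ax = 0 and ay = 0 and az = 0]) simp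
qed simp_all

lemma darboux_type_prod:
  fixes np nq :: nat
  assumes "\<forall>i<np. darboux_poly X (f i)" "\<forall>j<nq. exp_factor X (E j)"
    and "\<forall>p\<in>U. H p = (\<Prod>i<np. f i p) * (\<Prod>j<nq. E j p)"
  shows "darboux_type X U H"
  unfolding darboux_type_def
proof (intro exI conjI)
  show "\<forall>p\<in>U. complex_of_real (H p) =
      (\<Prod>i<np. complex_of_real (f i p) powr (\<lambda>_. 1) i) * (\<Prod>j<nq. complex_of_real (E j p) powr (\<lambda>_. 1) j)"
    using assms(3) by simp
qed (use assms(1,2) in auto)

lemma darboux_type_H1: "darboux_type (vf b) U H1"
proof (rule darboux_type_prod[where np = 2 and f = "\<lambda>i. if i = 0 then fst else (\<lambda>v. fst (snd v))"
      and nq = 1 and E = "\<lambda>_ v. exp (- fst v - fst (snd v))"])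
  show "\<forall>i<2. darboux_poly (vf b) (if i = 0 then fst else (\<lambda>v. fst (snd v)))"
    using darboux_poly_x darboux_poly_y by (auto simp: less_2_cases_iff)
qed (auto simp: exp_factor_exp_neg_x_y H1_def numeral_2_eq_2 lessThan_Suc)

lemma darboux_type_z: "darboux_type (vf b) U (\<lambda>(x, y, z). z)"
  by (rule darboux_type_prod[where np = 1 and f = "\<lambda>_ v. snd (snd v)" and nq = 0])
    (auto simp: darboux_poly_z)

section \<open>First integrals\<close>

lemma first_integral_H1:
  assumes "open U" "(1, 0, 0) \<in> U" "(1, -1, 0) \<in> U"
  shows "first_integral (vf b) U H1"
  unfolding first_integral_def
proof (intro conjI ballI)
  show "\<exists>p\<in>U. \<exists>q\<in>U. H1 p \<noteq> H1 q"
    using assms(2,3) by (force simp: H1_def)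
qed (use assms(1) H1_derivative_along_vf in metis)+

lemma first_integral_z: "first_integral (vf 0) UNIV (\<lambda>(x, y, z). z)"
  unfolding first_integral_def
proof (intro conjI ballI)
  show "\<exists>p\<in>UNIV :: pt3 set. \<exists>q\<in>UNIV :: pt3 set.
      (case p of (x, y, z) \<Rightarrow> z) \<noteq> (case q of (x, y, z) \<Rightarrow> z)"
    by (intro bexI[of _ "(0 :: real, 0 :: real, 0 :: real)"] bexI[of _ "(0 :: real, 0 :: real, 1 :: real)"])
      auto
  fix p :: pt3
  have "(\<lambda>(x, y, z). z) = (\<lambda>v :: pt3. snd (snd v))"
    by auto
  then show "\<exists>D. ((\<lambda>(x, y, z). z) has_derivative D) (at p) \<and> D (vf 0 p) = 0"
    by (auto intro!: exI[of _ "\<lambda>v. snd (snd v)"] derivative_eq_intros simp: vf_def split: prod.splits)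
qed simp

lemma open_H2_domain: "open {(x :: real, y :: real, z :: real). 0 < x \<and> y < 1}"
proof -
  have "{(x, y, z). 0 < x \<and> y < 1} = {v :: pt3. 0 < fst v} \<inter> {v. fst (snd v) < 1}"
    by auto
  also have "open \<dots>"
    by (intro open_Int open_Collect_less continuous_intros)
  finally show ?thesis .
qed

lemma first_integral_H2:
  "first_integral (vf b) {(x, y, z). 0 < x \<and> y < 1} (\<lambda>(x, y, z). z * hfun b x y)"
  unfolding first_integral_def
proof (intro conjI ballI)
  show "open {(x :: real, y :: real, z :: real). 0 < x \<and> y < 1}"
    by (rule open_H2_domain)
  have "hfun b 1 0 = 1"
    by (simp add: hfun_def oint_def)
  then show "\<exists>p\<in>{(x, y, z). 0 < x \<and> y < 1}. \<exists>q\<in>{(x, y, z). 0 < x \<and> y < 1}.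
      (case p of (x, y, z) \<Rightarrow> z * hfun b x y) \<noteq> (case q of (x, y, z) \<Rightarrow> z * hfun b x y)"
    by (intro bexI[of _ "(1 :: real, 0 :: real, 0 :: real)"] bexI[of _ "(1 :: real, 0 :: real, 1 :: real)"])
      auto
next
  fix p assume "p \<in> {(x :: real, y :: real, z :: real). 0 < x \<and> y < 1}"
  then obtain x y z where "p = (x, y, z)" "0 < x" "y < 1"
    by auto
  then show "\<exists>D. ((\<lambda>(x, y, z). z * hfun b x y) has_derivative D) (at p) \<and> D (vf b p) = 0"
    by (metis H2_derivative_along_vf)
qed

theorem theorem1p3:
  fixes b :: real
  assumes "b \<ge> 0"
  shows "(b = 0 \<longrightarrow>
            first_integral (vf b) UNIV H1 \<and> darboux_type (vf b) UNIV H1 \<and>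
            first_integral (vf b) UNIV (\<lambda>(x, y, z). z) \<and> darboux_type (vf b) UNIV (\<lambda>(x, y, z). z))
       \<and> (b > 0 \<longrightarrow>
            first_integral (vf b) {(x, y, z). 0 < x \<and> y < 1} H1 \<and>
            first_integral (vf b) {(x, y, z). 0 < x \<and> y < 1} (\<lambda>(x, y, z). z * hfun b x y))"
proof -
  have "first_integral (vf b) {(x, y, z). 0 < x \<and> y < 1} H1"
    by (rule first_integral_H1[OF open_H2_domain]) auto
  then show ?thesis
    using first_integral_H1[of UNIV] first_integral_z first_integral_H2 darboux_type_H1 darboux_type_z
    by auto
qed

end
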